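(* For every formula $A$ of $\mathbf{IQC}$: if $\vdash_{\mathbf{IQC}} A$ then $\vdash_{\mathbf{EQC}} A^{\Box_{\mathbf{RS}}}$. Likewise, for every formula $A$ of the language of arithmetic: if $\vdash_{\mathbf{HA}} A$ then $\vdash_{\mathbf{EA}} A^{\Box_{\mathbf{RS}}}$.
   Context: $\mathbf{IQC}$ is intuitionistic first-order predicate calculus with equality, with primitives $\vee,\wedge,\supset,\exists,\forall$ and the constant $\bot$; $\neg A$ abbreviates $A\supset\bot$. $\mathbf{EQC}$ is classical first-order predicate calculus with equality extended by a modal operator $\Box$ governed by the S4 rules ($\Box$-introduction: from $A$ infer $\Box A$ provided all open assumptions have the form $\Box B$; $\Box$-elimination: from $\Box A$ infer $A$); no Barcan formula is assumed. $\mathbf{HA}$ is Heyting arithmetic (language $0,s,+,\cdot$; axioms for zero and successor, defining equations of $+,\cdot$, induction for all formulas) over $\mathbf{IQC}$. $\mathbf{EA}$ (Shapiro's epistemic arithmetic) is the same arithmetic axioms, with induction for all formulas of the modal language, over $\mathbf{EQC}$ (i.e. $\mathbf{PA}$ plus S4). The modified Rasiowa–Sikorski translation $A\mapsto A^{\Box_{\mathbf{RS}}}$ is defined by induction on $A$: (i) if $A$ is $\bot$ or an equation $s=t$, $A^{\Box_{\mathbf{RS}}}=A$; (ii) if $A$ is any other atomic formula, $A^{\Box_{\mathbf{RS}}}=\Box A$; (iii) $(A\vee B)^{\Box_{\mathbf{RS}}}=\Box A^{\Box_{\mathbf{RS}}}\vee\Box B^{\Box_{\mathbf{RS}}}$;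 (iv) $(A\wedge B)^{\Box_{\mathbf{RS}}}=A^{\Box_{\mathbf{RS}}}\wedge B^{\Box_{\mathbf{RS}}}$; (v) $(A\supset B)^{\Box_{\mathbf{RS}}}=\Box(\Box A^{\Box_{\mathbf{RS}}}\supset\Box B^{\Box_{\mathbf{RS}}})$; (vi) $(\exists x A)^{\Box_{\mathbf{RS}}}=\exists x\,\Box A^{\Box_{\mathbf{RS}}}$; (vii) $(\forall x A)^{\Box_{\mathbf{RS}}}=\forall x\,A^{\Box_{\mathbf{RS}}}$. *)

theory Defs
  imports Main
begin

section \<open>Signatures, terms and formulas\<close>

text \<open>
  Variables are de Bruijn indices, so a quantifier binds index 0 of its body.  A signature assigns
  an arity to each of its symbols; symbols mapped to \<^const>\<open>None\<close> do not belong to the language.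
\<close>

record ('f, 'p) signature =
  fun_arity :: "'f \<Rightarrow> nat option"
  pred_arity :: "'p \<Rightarrow> nat option"

datatype 'f tm = Var nat | Fun 'f "'f tm list"

fun wf_tm :: "('f, 'p) signature \<Rightarrow> 'f tm \<Rightarrow> bool" where
  "wf_tm S (Var n) = True"
| "wf_tm S (Fun f ts) = (fun_arity S f = Some (length ts) \<and> (\<forall>t \<in> set ts. wf_tm S t))"

primrec subst_tm :: "(nat \<Rightarrow> 'f tm) \<Rightarrow> 'f tm \<Rightarrow> 'f tm" where
  "subst_tm \<sigma> (Var n) = \<sigma> n"
| "subst_tm \<sigma> (Fun f ts) = Fun f (map (subst_tm \<sigma>) ts)"

definition shift :: "nat \<Rightarrow> 'f tm" where
  "shift n = Var (Suc n)"

text \<open>The substitution to be used below a binder in place of \<open>\<sigma>\<close>.\<close>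

definition under :: "(nat \<Rightarrow> 'f tm) \<Rightarrow> nat \<Rightarrow> 'f tm" where
  "under \<sigma> = case_nat (Var 0) (\<lambda>n. subst_tm shift (\<sigma> n))"

text \<open>The substitution replacing index 0 by \<open>t\<close> in the body of a quantifier that is removed.\<close>

definition inst :: "'f tm \<Rightarrow> nat \<Rightarrow> 'f tm" where
  "inst t = case_nat t Var"

datatype ('f, 'p) fm =
    Falsum
  | Equ "'f tm" "'f tm"
  | Atom 'p "'f tm list"
  | Disj "('f, 'p) fm" "('f, 'p) fm"
  | Conj "('f, 'p) fm" "('f, 'p) fm"
  | Impl "('f, 'p) fm" "('f, 'p) fm"
  | Exists "('f, 'p) fm"
  | Forall "('f, 'p) fm"

abbreviation Neg :: "('f, 'p) fm \<Rightarrow> ('f, 'p) fm" where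
  "Neg A \<equiv> Impl A Falsum"

primrec wf_fm :: "('f, 'p) signature \<Rightarrow> ('f, 'p) fm \<Rightarrow> bool" where
  "wf_fm S Falsum = True"
| "wf_fm S (Equ s t) = (wf_tm S s \<and> wf_tm S t)"
| "wf_fm S (Atom p ts) = (pred_arity S p = Some (length ts) \<and> (\<forall>t \<in> set ts. wf_tm S t))"
| "wf_fm S (Disj A B) = (wf_fm S A \<and> wf_fm S B)"
| "wf_fm S (Conj A B) = (wf_fm S A \<and> wf_fm S B)"
| "wf_fm S (Impl A B) = (wf_fm S A \<and> wf_fm S B)"
| "wf_fm S (Exists A) = wf_fm S A"
| "wf_fm S (Forall A) = wf_fm S A"

primrec subst :: "(nat \<Rightarrow> 'f tm) \<Rightarrow> ('f, 'p) fm \<Rightarrow> ('f, 'p) fm" where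
  "subst \<sigma> Falsum = Falsum"
| "subst \<sigma> (Equ s t) = Equ (subst_tm \<sigma> s) (subst_tm \<sigma> t)"
| "subst \<sigma> (Atom p ts) = Atom p (map (subst_tm \<sigma>) ts)"
| "subst \<sigma> (Disj A B) = Disj (subst \<sigma> A) (subst \<sigma> B)"
| "subst \<sigma> (Conj A B) = Conj (subst \<sigma> A) (subst \<sigma> B)"
| "subst \<sigma> (Impl A B) = Impl (subst \<sigma> A) (subst \<sigma> B)"
| "subst \<sigma> (Exists A) = Exists (subst (under \<sigma>) A)"
| "subst \<sigma> (Forall A) = Forall (subst (under \<sigma>) A)"

text \<open>Formulas of the modal language.\<close>

datatype ('f, 'p) mfm =
    MFalsum
  | MEqu "'f tm" "'f tm"
  | MAtom 'p "'f tm list"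
  | MDisj "('f, 'p) mfm" "('f, 'p) mfm"
  | MConj "('f, 'p) mfm" "('f, 'p) mfm"
  | MImpl "('f, 'p) mfm" "('f, 'p) mfm"
  | MExists "('f, 'p) mfm"
  | MForall "('f, 'p) mfm"
  | Box "('f, 'p) mfm"

abbreviation MNeg :: "('f, 'p) mfm \<Rightarrow> ('f, 'p) mfm" where
  "MNeg A \<equiv> MImpl A MFalsum"

primrec wf_mfm :: "('f, 'p) signature \<Rightarrow> ('f, 'p) mfm \<Rightarrow> bool" where
  "wf_mfm S MFalsum = True"
| "wf_mfm S (MEqu s t) = (wf_tm S s \<and> wf_tm S t)"
| "wf_mfm S (MAtom p ts) = (pred_arity S p = Some (length ts) \<and> (\<forall>t \<in> set ts. wf_tm S t))"
| "wf_mfm S (MDisj A B) = (wf_mfm S A \<and> wf_mfm S B)"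
| "wf_mfm S (MConj A B) = (wf_mfm S A \<and> wf_mfm S B)"
| "wf_mfm S (MImpl A B) = (wf_mfm S A \<and> wf_mfm S B)"
| "wf_mfm S (MExists A) = wf_mfm S A"
| "wf_mfm S (MForall A) = wf_mfm S A"
| "wf_mfm S (Box A) = wf_mfm S A"

primrec msubst :: "(nat \<Rightarrow> 'f tm) \<Rightarrow> ('f, 'p) mfm \<Rightarrow> ('f, 'p) mfm" where
  "msubst \<sigma> MFalsum = MFalsum"
| "msubst \<sigma> (MEqu s t) = MEqu (subst_tm \<sigma> s) (subst_tm \<sigma> t)"
| "msubst \<sigma> (MAtom p ts) = MAtom p (map (subst_tm \<sigma>) ts)"
| "msubst \<sigma> (MDisj A B) = MDisj (msubst \<sigma> A) (msubst \<sigma> B)"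
| "msubst \<sigma> (MConj A B) = MConj (msubst \<sigma> A) (msubst \<sigma> B)"
| "msubst \<sigma> (MImpl A B) = MImpl (msubst \<sigma> A) (msubst \<sigma> B)"
| "msubst \<sigma> (MExists A) = MExists (msubst (under \<sigma>) A)"
| "msubst \<sigma> (MForall A) = MForall (msubst (under \<sigma>) A)"
| "msubst \<sigma> (Box A) = Box (msubst \<sigma> A)"


section \<open>Intuitionistic and classical S4 natural deduction\<close>

text \<open>
  In \<open>iderives S Ax \<Gamma> A\<close> and \<open>mderives S Ax \<Gamma> A\<close>, \<open>\<Gamma>\<close> contains all open assumptions of the
  derivation, whereas the members of \<open>Ax\<close> are axioms of the theory; an application of an axiom is
  not an open assumption.  Well-formedness is required wherever a rule would otherwise allow symbols
  outside the signature to enter.  Shifting \<open>\<Gamma>\<close> expresses the condition on the eigenvariable, which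
  is index 0.
\<close>

inductive iderives ::
  "('f, 'p) signature \<Rightarrow> ('f, 'p) fm set \<Rightarrow> ('f, 'p) fm set \<Rightarrow> ('f, 'p) fm \<Rightarrow> bool"
  for S :: "('f, 'p) signature" and Ax :: "('f, 'p) fm set"
where
  Ax: "\<lbrakk>A \<in> Ax; wf_fm S A\<rbrakk> \<Longrightarrow> iderives S Ax \<Gamma> A"
| Assm: "\<lbrakk>A \<in> \<Gamma>; wf_fm S A\<rbrakk> \<Longrightarrow> iderives S Ax \<Gamma> A"
| FalsumE: "\<lbrakk>iderives S Ax \<Gamma> Falsum; wf_fm S A\<rbrakk> \<Longrightarrow> iderives S Ax \<Gamma> A"
| DisjI1: "\<lbrakk>iderives S Ax \<Gamma> A; wf_fm S B\<rbrakk> \<Longrightarrow> iderives S Ax \<Gamma> (Disj A B)"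
| DisjI2: "\<lbrakk>iderives S Ax \<Gamma> B; wf_fm S A\<rbrakk> \<Longrightarrow> iderives S Ax \<Gamma> (Disj A B)"
| DisjE: "\<lbrakk>iderives S Ax \<Gamma> (Disj A B); iderives S Ax (insert A \<Gamma>) C; iderives S Ax (insert B \<Gamma>) C\<rbrakk>
    \<Longrightarrow> iderives S Ax \<Gamma> C"
| ConjI: "\<lbrakk>iderives S Ax \<Gamma> A; iderives S Ax \<Gamma> B\<rbrakk> \<Longrightarrow> iderives S Ax \<Gamma> (Conj A B)"
| ConjE1: "iderives S Ax \<Gamma> (Conj A B) \<Longrightarrow> iderives S Ax \<Gamma> A"
| ConjE2: "iderives S Ax \<Gamma> (Conj A B) \<Longrightarrow> iderives S Ax \<Gamma> B"
| ImplI: "\<lbrakk>iderives S Ax (insert A \<Gamma>) B; wf_fm S A\<rbrakk> \<Longrightarrow> iderives S Ax \<Gamma> (Impl A B)"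
| ImplE: "\<lbrakk>iderives S Ax \<Gamma> (Impl A B); iderives S Ax \<Gamma> A\<rbrakk> \<Longrightarrow> iderives S Ax \<Gamma> B"
| ExistsI: "\<lbrakk>iderives S Ax \<Gamma> (subst (inst t) A); wf_tm S t; wf_fm S A\<rbrakk>
    \<Longrightarrow> iderives S Ax \<Gamma> (Exists A)"
| ExistsE: "\<lbrakk>iderives S Ax \<Gamma> (Exists A);
      iderives S Ax (insert A (subst shift ` \<Gamma>)) (subst shift C)\<rbrakk> \<Longrightarrow> iderives S Ax \<Gamma> C"
| ForallI: "iderives S Ax (subst shift ` \<Gamma>) A \<Longrightarrow> iderives S Ax \<Gamma> (Forall A)"
| ForallE: "\<lbrakk>iderives S Ax \<Gamma> (Forall A); wf_tm S t\<rbrakk> \<Longrightarrow> iderives S Ax \<Gamma> (subst (inst t) A)"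
| EquI: "wf_tm S t \<Longrightarrow> iderives S Ax \<Gamma> (Equ t t)"
| EquE: "\<lbrakk>iderives S Ax \<Gamma> (Equ s t); iderives S Ax \<Gamma> (subst (inst s) A); wf_fm S A\<rbrakk>
    \<Longrightarrow> iderives S Ax \<Gamma> (subst (inst t) A)"

text \<open>
  The equality rule \<open>MEquE\<close> is available for all modal formulas.  In \<open>BoxI\<close> the open
  assumptions of the premise are among \<open>Box ` \<Delta>\<close>; \<open>\<Gamma>\<close> may contain further assumptions since it need
  only include the open ones.
\<close>

inductive mderives ::
  "('f, 'p) signature \<Rightarrow> ('f, 'p) mfm set \<Rightarrow> ('f, 'p) mfm set \<Rightarrow> ('f, 'p) mfm \<Rightarrow> bool"
  for S :: "('f, 'p) signature" and Ax :: "('f, 'p) mfm set"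
where
  MAx: "\<lbrakk>A \<in> Ax; wf_mfm S A\<rbrakk> \<Longrightarrow> mderives S Ax \<Gamma> A"
| MAssm: "\<lbrakk>A \<in> \<Gamma>; wf_mfm S A\<rbrakk> \<Longrightarrow> mderives S Ax \<Gamma> A"
| Classical: "\<lbrakk>mderives S Ax (insert (MNeg A) \<Gamma>) MFalsum; wf_mfm S A\<rbrakk> \<Longrightarrow> mderives S Ax \<Gamma> A"
| MDisjI1: "\<lbrakk>mderives S Ax \<Gamma> A; wf_mfm S B\<rbrakk> \<Longrightarrow> mderives S Ax \<Gamma> (MDisj A B)"
| MDisjI2: "\<lbrakk>mderives S Ax \<Gamma> B; wf_mfm S A\<rbrakk> \<Longrightarrow> mderives S Ax \<Gamma> (MDisj A B)"
| MDisjE: "\<lbrakk>mderives S Ax \<Gamma> (MDisj A B); mderives S Ax (insert A \<Gamma>) C;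
      mderives S Ax (insert B \<Gamma>) C\<rbrakk> \<Longrightarrow> mderives S Ax \<Gamma> C"
| MConjI: "\<lbrakk>mderives S Ax \<Gamma> A; mderives S Ax \<Gamma> B\<rbrakk> \<Longrightarrow> mderives S Ax \<Gamma> (MConj A B)"
| MConjE1: "mderives S Ax \<Gamma> (MConj A B) \<Longrightarrow> mderives S Ax \<Gamma> A"
| MConjE2: "mderives S Ax \<Gamma> (MConj A B) \<Longrightarrow> mderives S Ax \<Gamma> B"
| MImplI: "\<lbrakk>mderives S Ax (insert A \<Gamma>) B; wf_mfm S A\<rbrakk> \<Longrightarrow> mderives S Ax \<Gamma> (MImpl A B)"
| MImplE: "\<lbrakk>mderives S Ax \<Gamma> (MImpl A B); mderives S Ax \<Gamma> A\<rbrakk> \<Longrightarrow> mderives S Ax \<Gamma> B"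
| MExistsI: "\<lbrakk>mderives S Ax \<Gamma> (msubst (inst t) A); wf_tm S t; wf_mfm S A\<rbrakk>
    \<Longrightarrow> mderives S Ax \<Gamma> (MExists A)"
| MExistsE: "\<lbrakk>mderives S Ax \<Gamma> (MExists A);
      mderives S Ax (insert A (msubst shift ` \<Gamma>)) (msubst shift C)\<rbrakk> \<Longrightarrow> mderives S Ax \<Gamma> C"
| MForallI: "mderives S Ax (msubst shift ` \<Gamma>) A \<Longrightarrow> mderives S Ax \<Gamma> (MForall A)"
| MForallE: "\<lbrakk>mderives S Ax \<Gamma> (MForall A); wf_tm S t\<rbrakk> \<Longrightarrow> mderives S Ax \<Gamma> (msubst (inst t) A)"
| MEquI: "wf_tm S t \<Longrightarrow> mderives S Ax \<Gamma> (MEqu t t)"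
| MEquE: "\<lbrakk>mderives S Ax \<Gamma> (MEqu s t); mderives S Ax \<Gamma> (msubst (inst s) A); wf_mfm S A\<rbrakk>
    \<Longrightarrow> mderives S Ax \<Gamma> (msubst (inst t) A)"
| BoxI: "\<lbrakk>mderives S Ax (Box ` \<Delta>) A; Box ` \<Delta> \<subseteq> \<Gamma>\<rbrakk> \<Longrightarrow> mderives S Ax \<Gamma> (Box A)"
| BoxE: "mderives S Ax \<Gamma> (Box A) \<Longrightarrow> mderives S Ax \<Gamma> A"

definition IQC_provable :: "('f, 'p) signature \<Rightarrow> ('f, 'p) fm \<Rightarrow> bool" where
  "IQC_provable S A \<longleftrightarrow> iderives S {} {} A"

definition EQC_provable :: "('f, 'p) signature \<Rightarrow> ('f, 'p) mfm \<Rightarrow> bool" where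
  "EQC_provable S A \<longleftrightarrow> mderives S {} {} A"


section \<open>Arithmetic\<close>

datatype arith_fun = Zero | Succ | Plus | Times

text \<open>Equality is the only predicate of arithmetic: the element of \<^typ>\<open>unit\<close> gets no arity.\<close>

definition arith :: "(arith_fun, unit) signature" where
  "arith = \<lparr>fun_arity = (\<lambda>f. Some (case f of Zero \<Rightarrow> 0 | Succ \<Rightarrow> 1 | Plus \<Rightarrow> 2 | Times \<Rightarrow> 2)),
            pred_arity = (\<lambda>_. None)\<rparr>"

abbreviation zero :: "arith_fun tm" where "zero \<equiv> Fun Zero []"
abbreviation succ :: "arith_fun tm \<Rightarrow> arith_fun tm" where "succ t \<equiv> Fun Succ [t]"
abbreviation plus :: "arith_fun tm \<Rightarrow> arith_fun tm \<Rightarrow> arith_fun tm" where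
  "plus s t \<equiv> Fun Plus [s, t]"
abbreviation times :: "arith_fun tm \<Rightarrow> arith_fun tm \<Rightarrow> arith_fun tm" where
  "times s t \<equiv> Fun Times [s, t]"

text \<open>
  The substitution \<open>x := s x\<close> for the variable \<open>x\<close> with index 0, which stays bound by the same
  quantifier, so that the other indices are unchanged.
\<close>

definition step :: "nat \<Rightarrow> arith_fun tm" where
  "step = case_nat (succ (Var 0)) (\<lambda>n. Var (Suc n))"

text \<open>Parameters of an induction formula may occur free in the axiom.\<close>

inductive_set HA_axioms :: "(arith_fun, unit) fm set" where
  "Forall (Neg (Equ (succ (Var 0)) zero)) \<in> HA_axioms"
| "Forall (Forall (Impl (Equ (succ (Var 1)) (succ (Var 0))) (Equ (Var 1) (Var 0)))) \<in> HA_axioms"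
| "Forall (Equ (plus (Var 0) zero) (Var 0)) \<in> HA_axioms"
| "Forall (Forall (Equ (plus (Var 1) (succ (Var 0))) (succ (plus (Var 1) (Var 0))))) \<in> HA_axioms"
| "Forall (Equ (times (Var 0) zero) zero) \<in> HA_axioms"
| "Forall (Forall (Equ (times (Var 1) (succ (Var 0))) (plus (times (Var 1) (Var 0)) (Var 1))))
     \<in> HA_axioms"
| "Impl (Conj (subst (inst zero) A) (Forall (Impl A (subst step A)))) (Forall A) \<in> HA_axioms"

inductive_set EA_axioms :: "(arith_fun, unit) mfm set" where
  "MForall (MNeg (MEqu (succ (Var 0)) zero)) \<in> EA_axioms"
| "MForall (MForall (MImpl (MEqu (succ (Var 1)) (succ (Var 0))) (MEqu (Var 1) (Var 0))))
     \<in> EA_axioms"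
| "MForall (MEqu (plus (Var 0) zero) (Var 0)) \<in> EA_axioms"
| "MForall (MForall (MEqu (plus (Var 1) (succ (Var 0))) (succ (plus (Var 1) (Var 0)))))
     \<in> EA_axioms"
| "MForall (MEqu (times (Var 0) zero) zero) \<in> EA_axioms"
| "MForall (MForall (MEqu (times (Var 1) (succ (Var 0))) (plus (times (Var 1) (Var 0)) (Var 1))))
     \<in> EA_axioms"
| "MImpl (MConj (msubst (inst zero) A) (MForall (MImpl A (msubst step A)))) (MForall A)
     \<in> EA_axioms"

definition HA_provable :: "(arith_fun, unit) fm \<Rightarrow> bool" where
  "HA_provable A \<longleftrightarrow> iderives arith HA_axioms {} A"

definition EA_provable :: "(arith_fun, unit) mfm \<Rightarrow> bool" where
  "EA_provable A \<longleftrightarrow> mderives arith EA_axioms {} A"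


section \<open>The modified Rasiowa--Sikorski translation\<close>

primrec RS :: "('f, 'p) fm \<Rightarrow> ('f, 'p) mfm" where
  "RS Falsum = MFalsum"
| "RS (Equ s t) = MEqu s t"
| "RS (Atom p ts) = Box (MAtom p ts)"
| "RS (Disj A B) = MDisj (Box (RS A)) (Box (RS B))"
| "RS (Conj A B) = MConj (RS A) (RS B)"
| "RS (Impl A B) = Box (MImpl (Box (RS A)) (Box (RS B)))"
| "RS (Exists A) = MExists (Box (RS A))"
| "RS (Forall A) = MForall (RS A)"

end

(*
  By induction on the intuitionistic derivation, if A follows from a context, then the translation
  of A follows from the boxed translations of that context.  Since all open assumptions are then
  boxed, Box-introduction always applies, and it supplies the boxes that the translation puts in
  front of subformulas.  For arithmetic, the translated induction axiom for A follows from
  induction for the modal formula Box (RS A).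
*)
theory Submission
  imports Defs
begin

section \<open>Substitution and well-formedness\<close>

lemma subst_tm_subst_tm: "subst_tm \<tau> (subst_tm \<sigma> t) = subst_tm (\<lambda>n. subst_tm \<tau> (\<sigma> n)) t"
  by (induction t) auto

lemma subst_tm_Var: "subst_tm Var t = t"
  by (induction t) (auto intro: map_idI)

lemma subst_tm_inverse: "(\<And>n. subst_tm \<tau> (\<sigma> n) = Var n) \<Longrightarrow> subst_tm \<tau> (subst_tm \<sigma> t) = t"
  by (simp add: subst_tm_subst_tm subst_tm_Var)

lemma subst_tm_under_inverse:
  assumes "\<And>n. subst_tm \<tau> (\<sigma> n) = Var n"
  shows "subst_tm (under \<tau>) (under \<sigma> n) = Var n"
proof (cases n)
  case (Suc m)
  have "subst_tm (under \<tau>) (subst_tm shift (\<sigma> m)) = subst_tm shift (subst_tm \<tau> (\<sigma> m))"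
    by (simp add: subst_tm_subst_tm under_def shift_def)
  with Suc assms show ?thesis
    by (simp add: under_def shift_def)
qed (simp add: under_def)

text \<open>Being a left inverse on variables survives the passage below a binder, so the induction
  goes through for all pairs of substitutions at once.\<close>

lemma msubst_inverse:
  "(\<And>n. subst_tm \<tau> (\<sigma> n) = Var n) \<Longrightarrow> msubst \<tau> (msubst \<sigma> A) = A"
  by (induction A arbitrary: \<sigma> \<tau>)
    (simp_all add: subst_tm_inverse subst_tm_under_inverse map_idI)

text \<open>Needed to recover the body of a shifted universal formula when it is instantiated with
  the eigenvariable.\<close>

lemma msubst_inst_under_shift: "msubst (inst (Var 0)) (msubst (under shift) A) = A"
  by (rule msubst_inverse) (simp add: inst_def under_def shift_def split: nat.split)

lemma RS_subst: "RS (subst \<sigma> A) = msubst \<sigma> (RS A)"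
  by (induction A arbitrary: \<sigma>) simp_all

lemma wf_mfm_RS [simp]: "wf_mfm S (RS A) = wf_fm S A"
  by (induction A) simp_all

lemma wf_tm_subst_tm: "wf_tm S t \<Longrightarrow> (\<And>n. wf_tm S (\<sigma> n)) \<Longrightarrow> wf_tm S (subst_tm \<sigma> t)"
  by (induction t) auto

lemma wf_tm_under: "(\<And>n. wf_tm S (\<sigma> n)) \<Longrightarrow> wf_tm S (under \<sigma> n)"
  by (auto simp: under_def shift_def wf_tm_subst_tm split: nat.split)

lemma wf_mfm_msubst: "wf_mfm S A \<Longrightarrow> (\<And>n. wf_tm S (\<sigma> n)) \<Longrightarrow> wf_mfm S (msubst \<sigma> A)"
  by (induction A arbitrary: \<sigma>) (auto simp: wf_tm_subst_tm wf_tm_under)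

section \<open>Derived rules of the modal calculus\<close>

lemma mderives_mono: "mderives S Ax \<Gamma> A \<Longrightarrow> \<Gamma> \<subseteq> \<Gamma>' \<Longrightarrow> mderives S Ax \<Gamma>' A"
proof (induction arbitrary: \<Gamma>' rule: mderives.induct)
  case (Classical A \<Gamma>)
  then show ?case by (meson insert_mono mderives.Classical)
next
  case (MDisjE \<Gamma> A B C)
  then show ?case by (meson insert_mono mderives.MDisjE)
next
  case (MImplI A \<Gamma> B)
  then show ?case by (meson insert_mono mderives.MImplI)
next
  case (MExistsE \<Gamma> A C)
  then show ?case by (meson image_mono insert_mono mderives.MExistsE)
next
  case (MForallI \<Gamma> A)
  then show ?case by (meson image_mono mderives.MForallI)
next
  \<comment> \<open>The boxed context is kept as it is; only its inclusion in the larger context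
    changes.\<close>
  case (BoxI \<Delta> A \<Gamma>)
  then show ?case by (meson mderives.BoxI order_trans)
next
  case (MEquE \<Gamma> s t A)
  then show ?case by (meson mderives.MEquE)
qed (auto intro: mderives.intros)

lemma mderives_Box: "mderives S Ax (Box ` \<Delta>) A \<Longrightarrow> mderives S Ax (Box ` \<Delta>) (Box A)"
  by (rule BoxI) auto

text \<open>The passage from \<open>A\<close> to \<open>B\<close> takes place below the quantifier,
  where the context has been shifted; hence \<open>map\<close> is required in every context.\<close>

lemma mderives_MForall_map:
  assumes "mderives S Ax \<Gamma> (MForall A)" "wf_mfm S A"
    and map: "\<And>\<Gamma>'. mderives S Ax \<Gamma>' A \<Longrightarrow> mderives S Ax \<Gamma>' B"
  shows "mderives S Ax \<Gamma> (MForall B)"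
proof -
  \<comment> \<open>As an assumption, \<open>MForall A\<close> is shifted by \<open>MForallI\<close>
    along with the rest of the context; instantiating the shifted copy with index 0 gives back
    \<open>A\<close>.\<close>
  let ?\<Delta> = "insert (MForall A) \<Gamma>"
  have "wf_mfm S (msubst (under shift) A)"
    using assms(2) by (simp add: wf_mfm_msubst wf_tm_under shift_def)
  then have "mderives S Ax (msubst shift ` ?\<Delta>) (MForall (msubst (under shift) A))"
    by (intro MAssm) auto
  from MForallE[OF this, of "Var 0"] have "mderives S Ax (msubst shift ` ?\<Delta>) A"
    by (simp add: msubst_inst_under_shift)
  then have "mderives S Ax \<Gamma> (MImpl (MForall A) (MForall B))"
    using assms(2) by (intro MImplI MForallI map) auto
  then show ?thesis
    using assms(1) MImplE by blast
qed

text \<open>The context is boxed both before and after the antecedent is discharged, so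
  \<open>BoxI\<close> supplies first the box on the consequent and then the outer one.\<close>

lemma mderives_RS_Impl:
  assumes "mderives S Ax (insert (Box (RS A)) (Box ` \<Delta>)) (RS B)" "wf_fm S A"
  shows "mderives S Ax (Box ` \<Delta>) (RS (Impl A B))"
proof -
  have "mderives S Ax (insert (Box (RS A)) (Box ` \<Delta>)) (Box (RS B))"
    using mderives_Box[of S Ax "insert (RS A) \<Delta>"] assms(1) by simp
  then show ?thesis
    using assms(2) by (simp add: mderives_Box MImplI)
qed

section \<open>Soundness of the translation\<close>

theorem mderives_RS:
  assumes "iderives S Ax \<Gamma> A"
    and axioms: "\<And>B. B \<in> Ax \<Longrightarrow> wf_fm S B \<Longrightarrow> mderives S Ax' {} (RS B)"
  shows "mderives S Ax' (Box ` RS ` \<Gamma>) (RS A)"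
  using assms(1)
proof (induction rule: iderives.induct)
  case (Ax A \<Gamma>)
  then show ?case using axioms mderives_mono by blast
next
  case (Assm A \<Gamma>)
  then show ?case by (auto intro!: BoxE[OF MAssm])
next
  case (FalsumE \<Gamma> A)
  have "mderives S Ax' (insert (MNeg (RS A)) (Box ` RS ` \<Gamma>)) (RS Falsum)"
    using FalsumE.IH by (rule mderives_mono) auto
  with FalsumE.hyps show ?case by (auto intro: Classical)
next
  case (DisjI1 \<Gamma> A B)
  then show ?case by (auto intro: MDisjI1 mderives_Box)
next
  case (DisjI2 \<Gamma> B A)
  then show ?case by (auto intro: MDisjI2 mderives_Box)
next
  case (DisjE \<Gamma> A B C)
  then show ?case by (auto intro: MDisjE)
next
  case (ConjI \<Gamma> A B)
  then show ?case by (auto intro: MConjI)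
next
  case (ConjE1 \<Gamma> A B)
  then show ?case by (auto intro: MConjE1)
next
  case (ConjE2 \<Gamma> A B)
  then show ?case by (auto intro: MConjE2)
next
  case (ImplI A \<Gamma> B)
  then show ?case using mderives_RS_Impl[of S Ax' A "RS ` \<Gamma>" B] by simp
next
  case (ImplE \<Gamma> A B)
  then show ?case by (metis BoxE MImplE RS.simps(6) mderives_Box)
next
  case (ExistsI \<Gamma> t A)
  then show ?case by (auto intro!: MExistsI[of _ _ _ t] mderives_Box simp: RS_subst)
next
  case (ExistsE \<Gamma> A C)
  \<comment> \<open>The translated existential has a boxed body, so the assumption about the witness
    joins a context that stays boxed.\<close>
  show ?case
    by (rule MExistsE[where A = "Box (RS A)"]) (use ExistsE.IH in \<open>simp_all add: RS_subst image_image\<close>)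
next
  case (ForallI \<Gamma> A)
  then show ?case by (simp add: MForallI RS_subst image_image)
next
  case (ForallE \<Gamma> A t)
  then show ?case by (simp add: MForallE RS_subst)
next
  case (EquI t \<Gamma>)
  then show ?case by (auto intro: MEquI)
next
  case (EquE \<Gamma> s t A)
  \<comment> \<open>Equations carry no box and \<open>MEquE\<close> covers modal formulas, so
    replacement can be done directly in \<open>RS A\<close>.\<close>
  then show ?case by (simp add: RS_subst) (metis MEquE wf_mfm_RS)
qed

section \<open>Translated axioms of arithmetic\<close>

lemma mderives_RS_Impl_closed:
  assumes "mderives S Ax {} (MImpl (RS A) (RS B))" "wf_fm S A"
  shows "mderives S Ax {} (RS (Impl A B))"
proof -
  have "mderives S Ax {Box (RS A)} (MImpl (RS A) (RS B))"
    using assms(1) mderives_mono by blast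
  moreover have "mderives S Ax {Box (RS A)} (RS A)"
    using assms(2) by (intro BoxE[OF MAssm]) auto
  ultimately show ?thesis
    using mderives_RS_Impl[of S Ax A "{}" B] assms(2) MImplE by fastforce
qed

lemma EA_successor_nonzero: "mderives arith EA_axioms \<Gamma> (MNeg (MEqu (succ (Var 0)) zero))"
proof -
  have "mderives arith EA_axioms \<Gamma> (MForall (MNeg (MEqu (succ (Var 0)) zero)))"
    by (rule MAx[OF EA_axioms.intros(1)]) (simp add: arith_def)
  from MForallE[OF this, of "Var 0"] show ?thesis
    by (simp add: inst_def)
qed

lemma EA_successor_inject:
  "mderives arith EA_axioms \<Gamma> (MImpl (MEqu (succ (Var 1)) (succ (Var 0))) (MEqu (Var 1) (Var 0)))"
proof -
  have "mderives arith EA_axioms \<Gamma>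
      (MForall (MForall (MImpl (MEqu (succ (Var 1)) (succ (Var 0))) (MEqu (Var 1) (Var 0)))))"
    by (rule MAx[OF EA_axioms.intros(2)]) (simp add: arith_def)
  \<comment> \<open>Below the inner binder the term \<open>Var 1\<close> becomes
    \<open>Var 2\<close>; removing that binder next lowers it to \<open>Var 1\<close> again.\<close>
  from MForallE[OF this, of "Var 1"]
  have "mderives arith EA_axioms \<Gamma>
      (MForall (MImpl (MEqu (succ (Var 2)) (succ (Var 0))) (MEqu (Var 2) (Var 0))))"
    by (simp add: inst_def under_def shift_def numeral_2_eq_2)
  from MForallE[OF this, of "Var 0"] show ?thesis
    by (simp add: inst_def numeral_2_eq_2)
qed

text \<open>The translated step leads from \<open>Box (RS A)\<close> to its own successor instance,
  so the boxed formula is the one to induct on. Its base case is boxed because the only assumption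
  is.\<close>

lemma EA_RS_induction:
  assumes wf: "wf_fm arith (Impl (Conj (subst (inst zero) A) (Forall (Impl A (subst step A)))) (Forall A))"
  shows "mderives arith EA_axioms {}
    (RS (Impl (Conj (subst (inst zero) A) (Forall (Impl A (subst step A)))) (Forall A)))"
proof -
  let ?base = "subst (inst zero) A" and ?step = "Forall (Impl A (subst step A))"
  let ?H = "RS (Conj ?base ?step)"
  have hyp: "mderives arith EA_axioms {Box ?H} ?H"
    using wf by (intro BoxE[OF MAssm]) auto
  have "mderives arith EA_axioms {Box ?H} (Box (RS ?base))"
    using mderives_Box[of _ _ "{?H}"] hyp MConjE1 by fastforce
  then have base: "mderives arith EA_axioms {Box ?H} (msubst (inst zero) (Box (RS A)))"
    by (simp add: RS_subst)
  have "mderives arith EA_axioms {Box ?H} (MForall (RS (Impl A (subst step A))))"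
    using hyp MConjE2 by fastforce
  \<comment> \<open>The translated implication has an outer box, which is dropped under the
    quantifier.\<close>
  then have step: "mderives arith EA_axioms {Box ?H}
      (MForall (MImpl (Box (RS A)) (msubst step (Box (RS A)))))"
    by (rule mderives_MForall_map) (use wf in \<open>auto intro: BoxE simp flip: RS_subst\<close>)
  have "mderives arith EA_axioms {Box ?H}
      (MImpl (MConj (msubst (inst zero) (Box (RS A)))
        (MForall (MImpl (Box (RS A)) (msubst step (Box (RS A)))))) (MForall (Box (RS A))))"
    by (rule MAx[OF EA_axioms.intros(7)]) (use wf in \<open>simp flip: RS_subst\<close>)
  from MImplE[OF this MConjI[OF base step]]
  \<comment> \<open>Induction yields a box inside the quantifier; eliminating it there leaves the
    translation of \<open>Forall A\<close>.\<close>
  have "mderives arith EA_axioms {Box ?H} (RS (Forall A))"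
    unfolding RS.simps by (rule mderives_MForall_map) (use wf in \<open>auto intro: BoxE\<close>)
  then show ?thesis
    using mderives_RS_Impl[of arith EA_axioms "Conj ?base ?step" "{}" "Forall A"] wf by simp
qed

lemma EA_RS_HA_axiom:
  assumes "A \<in> HA_axioms" "wf_fm arith A"
  shows "mderives arith EA_axioms {} (RS A)"
  using assms
proof cases
  case 1
  have "mderives arith EA_axioms {} (RS (Neg (Equ (succ (Var 0)) zero)))"
    using EA_successor_nonzero by (intro mderives_RS_Impl_closed) (simp_all, simp add: arith_def)
  with 1 show ?thesis by (auto intro: MForallI)
next
  case 2
  have "mderives arith EA_axioms {}
      (RS (Impl (Equ (succ (Var 1)) (succ (Var 0))) (Equ (Var 1) (Var 0))))"
    using EA_successor_inject by (intro mderives_RS_Impl_closed) (simp_all, simp add: arith_def)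
  with 2 show ?thesis by (auto intro!: MForallI)
next
  case (7 B)
  with assms(2) EA_RS_induction show ?thesis by blast
\<comment> \<open>The remaining axioms are universally quantified equations, which \<open>RS\<close>
  leaves unchanged.\<close>
qed (use assms(2) in \<open>auto intro!: MAx intro: EA_axioms.intros[simplified]\<close>)

theorem theorem2p1:
  fixes S :: "('f, 'p) signature"
  shows "(\<forall>A :: ('f, 'p) fm. wf_fm S A \<longrightarrow> IQC_provable S A \<longrightarrow> EQC_provable S (RS A)) \<and>
         (\<forall>A :: (arith_fun, unit) fm. wf_fm arith A \<longrightarrow> HA_provable A \<longrightarrow> EA_provable (RS A))"
  using mderives_RS[of S "{}" "{}" _ "{}"] mderives_RS[of arith HA_axioms "{}" _ EA_axioms]
    EA_RS_HA_axiom
  by (auto simp: IQC_provable_def EQC_provable_def HA_provable_def EA_provable_def)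

end
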